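(* In the steady state of the job-search process on the labor flow network $\mathbf{A}$ with investment probability $v$, separation probability $\lambda$ and hiring policies $\{h_i\}_{i=1}^N$, the average size of every firm $i$ is $$L_i = \frac{\varphi}{\lambda}\,h_i\,\bar{h}_{\Gamma_i}\,k_i,$$ where $\bar{h}_{\Gamma_i}=\frac{1}{k_i}\sum_j\mathbf{A}_{ij}h_j$ is the average hiring policy of $i$'s neighbor firms and $\varphi$ is the normalizing constant $$\varphi = \frac{H}{\sum_{i=1}^N h_i \bar{h}_{\Gamma_i} k_i \left[ \frac{1}{\lambda} + \frac{1}{\bar{h}_{\Gamma_i} [1-(1-v)^{k_i}]} \right]}.$$
   Context: There are $N\ge 2$ firms $\{1,\dots,N\}$, the nodes of a labor flow network: a connected, undirected, unweighted graph without self-loops, with symmetric $0/1$ adjacency matrix $\mathbf{A}$. $\Gamma_i=\{j:\mathbf{A}_{ij}=1\}$ is the neighbor set of firm $i$ and $k_i=|\Gamma_i|$ its degree. Parameters: $v\in(0,1]$, $\lambda\in(0,1]$, and a hiring policy $h_i\in(0,1]$ for each firm. There are $H$ workers, acting independently of each other; every worker is at each time either employed at a firm or unemployed and associated to a firm (his or her last employer). Each period: (1) each firm independently receives an investment (is "open") with probability $v$; (2) each employed worker becomes unemployed with probability $\lambda$ and stays associated to the last employer; (3) each unemployed worker associated to $i$ (excluding newly separated ones) picks a firm $j$ uniformly at random from the set $\gamma_i\subseteq\Gamma_i$ of open neighbors of $i$ and becomes employed at $j$ with probability $h_j$; otherwise (including when $\gamma_i=\emptyset$) the worker remains unemployed and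 associated to $i$. Let $p_i(t)$ be the probability that a worker is employed at $i$ in period $t$, and $q_i(t)$ the probability that a worker is unemployed in period $t$ and associated to $i$. With $\Pr_i(\gamma)=v^{|\gamma|}(1-v)^{k_i-|\gamma|}$ for $\gamma\subseteq\Gamma_i$ (the probability that the set of open neighbors of $i$ is $\gamma$), they satisfy $$p_i(t) = (1-\lambda)p_i(t-1) + h_i \sum_{j \in \Gamma_i}q_j(t-1) \sum_{\gamma\subseteq\Gamma_j,\ i\in\gamma} \Pr{}_j(\gamma) \frac{1}{|\gamma|},$$ $$q_i(t) = \lambda p_i(t-1) + q_i(t-1) \left[ \sum_{\emptyset\neq\gamma\subseteq\Gamma_i} \Pr{}_i(\gamma) \frac{1}{|\gamma|} \sum_{j \in \gamma} (1-h_j) + \Pr{}_i(\emptyset) \right].$$ The steady state is the time-invariant solution $(p_i,q_i)_{i=1}^N$ with $\sum_i p_i+\sum_i q_i=1$. The steady-state average size of firm $i$ is the expected number of workers employed at $i$ in the steady state, $L_i=Hp_i$. *)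

theory Defs
  imports "HOL-Analysis.Analysis"
begin

text \<open>The index type \<open>'n\<close> is the set of firms, so that \<open>N = CARD('n)\<close>.\<close>

definition labor_flow_network :: "real^'n^'n \<Rightarrow> bool" where
  "labor_flow_network A \<longleftrightarrow>
     (\<forall>i j. A $ i $ j = 0 \<or> A $ i $ j = 1) \<and>
     (\<forall>i j. A $ i $ j = A $ j $ i) \<and>
     (\<forall>i. A $ i $ i = 0) \<and>
     (\<forall>i j. (i, j) \<in> {(i, j). A $ i $ j = 1}\<^sup>*)"

definition nbrs :: "real^'n^'n \<Rightarrow> 'n \<Rightarrow> 'n set" where
  "nbrs A i = {j. A $ i $ j = 1}"

definition deg :: "real^'n^'n \<Rightarrow> 'n \<Rightarrow> nat" where
  "deg A i = card (nbrs A i)"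

text \<open>For \<open>\<gamma> \<subseteq> nbrs A i\<close>: the probability that \<open>\<gamma>\<close> is exactly the set of open neighbors of \<open>i\<close>.\<close>

definition open_prob :: "real^'n^'n \<Rightarrow> real \<Rightarrow> 'n \<Rightarrow> 'n set \<Rightarrow> real" where
  "open_prob A v i \<gamma> = v ^ card \<gamma> * (1 - v) ^ (deg A i - card \<gamma>)"

text \<open>In period \<open>t\<close>, a given worker is employed at \<open>i\<close> with probability \<open>p t $ i\<close>, and unemployed
  and associated to \<open>i\<close> with probability \<open>q t $ i\<close>. The separation probability is \<open>l\<close>.\<close>

definition job_search_dynamics ::
  "real^'n^'n \<Rightarrow> real \<Rightarrow> real \<Rightarrow> real^'n \<Rightarrow> (nat \<Rightarrow> real^'n) \<Rightarrow> (nat \<Rightarrow> real^'n) \<Rightarrow> bool" where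
  "job_search_dynamics A v l h p q \<longleftrightarrow>
     (\<forall>t i.
        p (Suc t) $ i = (1 - l) * p t $ i
          + h $ i * (\<Sum>j\<in>nbrs A i. q t $ j *
              (\<Sum>\<gamma> | \<gamma> \<subseteq> nbrs A j \<and> i \<in> \<gamma>. open_prob A v j \<gamma> * (1 / real (card \<gamma>)))) \<and>
        q (Suc t) $ i = l * p t $ i
          + q t $ i *
              ((\<Sum>\<gamma> | \<gamma> \<noteq> {} \<and> \<gamma> \<subseteq> nbrs A i.
                  open_prob A v i \<gamma> * (1 / real (card \<gamma>)) * (\<Sum>j\<in>\<gamma>. 1 - h $ j))
               + open_prob A v i {}))"

definition steady_state ::
  "real^'n^'n \<Rightarrow> real \<Rightarrow> real \<Rightarrow> real^'n \<Rightarrow> real^'n \<Rightarrow> real^'n \<Rightarrow> bool" where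
  "steady_state A v l h p q \<longleftrightarrow>
     job_search_dynamics A v l h (\<lambda>_. p) (\<lambda>_. q) \<and>
     (\<Sum>i\<in>UNIV. p $ i) + (\<Sum>i\<in>UNIV. q $ i) = 1"

definition average_size :: "nat \<Rightarrow> real^'n \<Rightarrow> 'n \<Rightarrow> real" where
  "average_size H p i = real H * p $ i"

definition nbr_avg :: "real^'n^'n \<Rightarrow> real^'n \<Rightarrow> 'n \<Rightarrow> real" where
  "nbr_avg A h i = 1 / real (deg A i) * (\<Sum>j\<in>UNIV. A $ i $ j * h $ j)"

definition norm_const :: "nat \<Rightarrow> real^'n^'n \<Rightarrow> real \<Rightarrow> real \<Rightarrow> real^'n \<Rightarrow> real" where
  "norm_const H A v l h =
     real H / (\<Sum>i\<in>UNIV. h $ i * nbr_avg A h i * real (deg A i) *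
       (1 / l + 1 / (nbr_avg A h i * (1 - (1 - v) ^ deg A i))))"

end

theory Submission
  imports Defs
begin

text \<open>Every neighbor of \<open>i\<close> is equally likely to be the one picked, so a given neighbor is picked with
  probability \<open>c\<^sub>i = (1 - (1 - v) ^ k\<^sub>i) / k\<^sub>i\<close>. With \<open>x\<^sub>i = c\<^sub>i q\<^sub>i\<close> the steady-state equations
  become \<open>l p\<^sub>i = h\<^sub>i (\<Sum>j\<in>\<Gamma>\<^sub>i. x\<^sub>j) = x\<^sub>i (\<Sum>j\<in>\<Gamma>\<^sub>i. h\<^sub>j)\<close>. For \<open>y\<^sub>i = x\<^sub>i / h\<^sub>i\<close> the second equality says
  that \<open>y\<close> is harmonic for the edge weights \<open>h\<^sub>i h\<^sub>j\<close>, so by the maximum principle it is constant on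
  the connected network, and the normalization determines the constant.\<close>

section \<open>Sums over the subsets of a finite set\<close>

lemma sum_Pow_binomial:
  fixes a b :: "'a::comm_semiring_1"
  assumes "finite S"
  shows "(\<Sum>T\<in>Pow S. a ^ card T * b ^ (card S - card T)) = (a + b) ^ card S"
proof -
  have "(a + b) ^ card S = (\<Sum>T\<in>Pow S. (\<Prod>x\<in>T. a) * (\<Prod>x\<in>S - T. b))"
    using prod_add[OF assms, of "\<lambda>_. a" "\<lambda>_. b"] by simp
  also have "\<dots> = (\<Sum>T\<in>Pow S. a ^ card T * b ^ (card S - card T))"
    using assms by (intro sum.cong) (auto simp: card_Diff_subset finite_subset)
  finally show ?thesis ..
qed

lemma sum_nonempty_subsets_swap:
  fixes f :: "'a set \<Rightarrow> 'b::comm_semiring_0"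
  assumes "finite S"
  shows "(\<Sum>T | T \<noteq> {} \<and> T \<subseteq> S. f T * (\<Sum>j\<in>T. w j)) = (\<Sum>j\<in>S. w j * (\<Sum>T | T \<subseteq> S \<and> j \<in> T. f T))"
proof -
  have "(\<Sum>T | T \<noteq> {} \<and> T \<subseteq> S. f T * (\<Sum>j\<in>T. w j)) = (\<Sum>T\<in>Pow S. f T * (\<Sum>j\<in>T. w j))"
    using assms by (intro sum.mono_neutral_left) auto
  also have "\<dots> = (\<Sum>T\<in>Pow S. \<Sum>j | j \<in> S \<and> j \<in> T. f T * w j)"
    by (intro sum.cong) (auto simp: sum_distrib_left intro!: sum.cong)
  also have "\<dots> = (\<Sum>j\<in>S. \<Sum>T | T \<in> Pow S \<and> j \<in> T. f T * w j)"
    using assms by (intro sum.swap_restrict) auto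
  also have "\<dots> = (\<Sum>j\<in>S. w j * (\<Sum>T | T \<subseteq> S \<and> j \<in> T. f T))"
    by (simp add: sum_distrib_left mult.commute)
  finally show ?thesis .
qed

text \<open>The transposition of \<open>i\<close> and \<open>j\<close> maps \<open>S\<close> onto
  itself, so taking images preserves cardinality and exchanges the two families of subsets.\<close>

lemma sum_subsets_containing_eq:
  assumes "i \<in> S" "j \<in> S"
  shows "(\<Sum>T | T \<subseteq> S \<and> i \<in> T. f (card T)) = (\<Sum>T | T \<subseteq> S \<and> j \<in> T. f (card T))"
proof -
  let ?t = "Transposition.transpose i j"
  have S: "?t ` S = S"
    using assms by simp
  have mem: "?t x \<in> ?t ` T \<longleftrightarrow> x \<in> T" for x T
    by (simp add: inj_image_mem_iff)
  have sub: "?t ` T \<subseteq> S" if "T \<subseteq> S" for T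
    using image_mono[OF that, of ?t] S by simp
  have i: "i \<in> ?t ` T" if "j \<in> T" for T
    using mem[of j T] that by simp
  have j: "j \<in> ?t ` T" if "i \<in> T" for T
    using mem[of i T] that by simp
  show ?thesis
    by (rule sum.reindex_bij_witness[where i = "image ?t" and j = "image ?t"])
       (use sub i j in \<open>auto simp: image_image card_image\<close>)
qed

section \<open>Probabilities of picking a neighbor and of staying unemployed\<close>

definition pick_prob :: "real^'n^'n \<Rightarrow> real \<Rightarrow> 'n \<Rightarrow> real" where
  "pick_prob A v i = (1 - (1 - v) ^ deg A i) / real (deg A i)"

lemma sum_open_prob_nonempty:
  "(\<Sum>\<gamma> | \<gamma> \<noteq> {} \<and> \<gamma> \<subseteq> nbrs A i. open_prob A v i \<gamma>) = 1 - (1 - v) ^ deg A i"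
proof -
  have "(\<Sum>\<gamma>\<in>Pow (nbrs A i). open_prob A v i \<gamma>) = 1"
    using sum_Pow_binomial[of "nbrs A i" v "1 - v"] by (simp add: open_prob_def deg_def)
  moreover have "{\<gamma>. \<gamma> \<noteq> {} \<and> \<gamma> \<subseteq> nbrs A i} = Pow (nbrs A i) - {{}}"
    by auto
  ultimately show ?thesis
    by (simp add: sum_diff1 open_prob_def)
qed

text \<open>By symmetry the sum has the same value \<open>c\<close> for every neighbor. Summing over
  all neighbors counts each nonempty \<gamma> exactly \<open>card \<gamma>\<close> times, which
  cancels the weight \<open>1 / card \<gamma>\<close>; so \<open>deg A i * c\<close> is the
  probability that some neighbor is open.\<close>

lemma sum_open_prob_containing:
  assumes "j \<in> nbrs A i"
  shows "(\<Sum>\<gamma> | \<gamma> \<subseteq> nbrs A i \<and> j \<in> \<gamma>. open_prob A v i \<gamma> * (1 / real (card \<gamma>))) = pick_prob A v i"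
proof -
  define g where "g \<gamma> = open_prob A v i \<gamma> * (1 / real (card \<gamma>))" for \<gamma>
  define c where "c = (\<Sum>\<gamma> | \<gamma> \<subseteq> nbrs A i \<and> j \<in> \<gamma>. g \<gamma>)"
  have c: "(\<Sum>\<gamma> | \<gamma> \<subseteq> nbrs A i \<and> j' \<in> \<gamma>. g \<gamma>) = c" if "j' \<in> nbrs A i" for j'
    unfolding c_def g_def open_prob_def by (rule sum_subsets_containing_eq) (use that assms in auto)
  have "1 - (1 - v) ^ deg A i = (\<Sum>\<gamma> | \<gamma> \<noteq> {} \<and> \<gamma> \<subseteq> nbrs A i. g \<gamma> * (\<Sum>j\<in>\<gamma>. 1))"
    unfolding sum_open_prob_nonempty[symmetric] g_def
    by (intro sum.cong) (auto simp: card_eq_0_iff)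
  also have "\<dots> = (\<Sum>j\<in>nbrs A i. 1 * c)"
    by (subst sum_nonempty_subsets_swap) (use c in \<open>auto intro!: sum.cong\<close>)
  also have "\<dots> = real (deg A i) * c"
    by (simp add: deg_def)
  finally have "1 - (1 - v) ^ deg A i = real (deg A i) * c" .
  moreover have "deg A i \<noteq> 0"
    using assms by (auto simp: deg_def card_eq_0_iff)
  ultimately show ?thesis
    by (simp add: pick_prob_def c_def g_def)
qed

text \<open>Complementary event: leaving unemployment means picking some neighbor \<open>j\<close>
  and being hired there, with probability \<open>pick_prob A v i * h $ j\<close>.\<close>

lemma stay_prob_eq:
  assumes "deg A i > 0"
  shows "(\<Sum>\<gamma> | \<gamma> \<noteq> {} \<and> \<gamma> \<subseteq> nbrs A i.
            open_prob A v i \<gamma> * (1 / real (card \<gamma>)) * (\<Sum>j\<in>\<gamma>. 1 - h $ j))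
          + open_prob A v i {}
        = 1 - pick_prob A v i * (\<Sum>j\<in>nbrs A i. h $ j)"
proof -
  have "(\<Sum>\<gamma> | \<gamma> \<noteq> {} \<and> \<gamma> \<subseteq> nbrs A i.
            open_prob A v i \<gamma> * (1 / real (card \<gamma>)) * (\<Sum>j\<in>\<gamma>. 1 - h $ j))
      = (\<Sum>j\<in>nbrs A i. (1 - h $ j) * pick_prob A v i)"
    by (subst sum_nonempty_subsets_swap)
       (auto simp: sum_open_prob_containing simp del: times_divide_eq_right intro!: sum.cong)
  also have "\<dots> = (real (deg A i) - (\<Sum>j\<in>nbrs A i. h $ j)) * pick_prob A v i"
    by (simp add: sum_distrib_right[symmetric] sum_subtractf deg_def)
  finally have "(\<Sum>\<gamma> | \<gamma> \<noteq> {} \<and> \<gamma> \<subseteq> nbrs A i.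
            open_prob A v i \<gamma> * (1 / real (card \<gamma>)) * (\<Sum>j\<in>\<gamma>. 1 - h $ j))
      = (real (deg A i) - (\<Sum>j\<in>nbrs A i. h $ j)) * pick_prob A v i" .
  \<comment> \<open>This is the probability that some neighbor is open; together with the term for
    the empty set it makes up the leading 1.\<close>
  moreover have "real (deg A i) * pick_prob A v i = 1 - (1 - v) ^ deg A i"
    using assms by (simp add: pick_prob_def)
  moreover have "open_prob A v i {} = (1 - v) ^ deg A i"
    by (simp add: open_prob_def)
  ultimately show ?thesis
    by (simp only: left_diff_distrib) simp
qed

section \<open>Connectedness and the maximum principle\<close>

lemma sum_adjacency_eq_sum_nbrs:
  assumes "labor_flow_network A"
  shows "(\<Sum>j\<in>UNIV. A $ i $ j * f j) = (\<Sum>j\<in>nbrs A i. f j)"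
proof -
  have "(\<Sum>j\<in>UNIV. A $ i $ j * f j) = (\<Sum>j\<in>nbrs A i. A $ i $ j * f j)"
    using assms unfolding labor_flow_network_def
    by (intro sum.mono_neutral_right) (auto simp: nbrs_def)
  then show ?thesis
    by (simp add: nbrs_def)
qed

lemma labor_flow_network_induct:
  assumes "labor_flow_network A" "P i" "\<And>j k. P j \<Longrightarrow> k \<in> nbrs A j \<Longrightarrow> P k"
  shows "P j"
proof -
  have "(i, j) \<in> {(i, j). A $ i $ j = 1}\<^sup>*"
    using assms(1) by (simp add: labor_flow_network_def)
  then show ?thesis
    by (induction rule: rtrancl_induct) (use assms in \<open>auto simp: nbrs_def\<close>)
qed

lemma deg_pos:
  fixes A :: "real^'n^'n"
  assumes "CARD('n) \<ge> 2" "labor_flow_network A"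
  shows "deg A i > 0"
proof (rule ccontr)
  assume "\<not> deg A i > 0"
  then have "nbrs A i = {}"
    by (simp add: deg_def)
  \<comment> \<open>Without neighbors of \<open>i\<close>, the property of being \<open>i\<close>
    passes vacuously along edges, so it reaches every firm.\<close>
  then have "j = i" for j
    using labor_flow_network_induct[OF assms(2), of "\<lambda>k. k = i" i j] by auto
  then have "(UNIV :: 'n set) = {i}"
    by auto
  then have "CARD('n) = 1"
    by (metis card_1_singleton_iff One_nat_def)
  with assms(1) show False
    by simp
qed

text \<open>Where \<open>y\<close> attains its maximum, all terms of the vanishing sum are
  nonnegative, hence zero. As the weights are positive, the maximum is attained at every neighbor
  too, and connectedness spreads it everywhere.\<close>

lemma harmonic_imp_constant:
  fixes A :: "real^'n^'n" and w :: "'n \<Rightarrow> 'n \<Rightarrow> real"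
  assumes net: "labor_flow_network A"
    and w: "\<And>i j. j \<in> nbrs A i \<Longrightarrow> w i j > 0"
    and harm: "\<And>i. (\<Sum>j\<in>nbrs A i. w i j * (y i - y j)) = 0"
  shows "y i = y j"
proof -
  define M where "M = Max (range y)"
  have le: "y k \<le> M" for k
    by (simp add: M_def)
  have "M \<in> range y"
    unfolding M_def by (intro Max_in) auto
  then obtain m where m: "y m = M"
    by auto
  have step: "y k' = M" if "y k = M" "k' \<in> nbrs A k" for k k'
  proof -
    have "\<forall>j\<in>nbrs A k. w k j * (y k - y j) = 0"
      using harm[of k] w[of _ k] le that(1)
      by (subst (asm) sum_nonneg_eq_0_iff) (auto intro!: mult_nonneg_nonneg intro: less_imp_le)
    with w[OF that(2)] that show ?thesis
      by auto
  qed
  have "y k = M" for k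
    by (rule labor_flow_network_induct[OF net, of "\<lambda>k. y k = M", OF m step])
  then show ?thesis
    by simp
qed

section \<open>The balance equations and their solutions\<close>

lemma nbrs_sym: "labor_flow_network A \<Longrightarrow> j \<in> nbrs A i \<longleftrightarrow> i \<in> nbrs A j"
  by (simp add: labor_flow_network_def nbrs_def)

text \<open>Flow balance: the separations at \<open>i\<close> equal both the hires by
  \<open>i\<close> and the exits from unemployment associated to \<open>i\<close>.\<close>

lemma steady_state_iff_balance:
  fixes A :: "real^'n^'n"
  assumes "CARD('n) \<ge> 2" and net: "labor_flow_network A"
  shows "steady_state A v l h p q \<longleftrightarrow>
    (\<forall>i. l * p $ i = h $ i * (\<Sum>j\<in>nbrs A i. q $ j * pick_prob A v j) \<and>
         l * p $ i = q $ i * (pick_prob A v i * (\<Sum>j\<in>nbrs A i. h $ j))) \<and>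
    (\<Sum>i\<in>UNIV. p $ i) + (\<Sum>i\<in>UNIV. q $ i) = 1"
proof -
  \<comment> \<open>The sum runs over neighbors of \<open>i\<close>, whereas the pick probability
    concerns \<open>i\<close> as a neighbor of \<open>j\<close>; symmetry of the network reconciles
    them.\<close>
  have hires: "(\<Sum>j\<in>nbrs A i. q $ j *
          (\<Sum>\<gamma> | \<gamma> \<subseteq> nbrs A j \<and> i \<in> \<gamma>. open_prob A v j \<gamma> * (1 / real (card \<gamma>))))
        = (\<Sum>j\<in>nbrs A i. q $ j * pick_prob A v j)" for i
    using nbrs_sym[OF net] by (intro sum.cong) (auto simp: sum_open_prob_containing simp del: times_divide_eq_right)
  have p_eq: "x = (1 - l) * x + z \<longleftrightarrow> l * x = z" for x z :: real
    by (auto simp: algebra_simps)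
  have q_eq: "x = z + x * (1 - w) \<longleftrightarrow> z = x * w" for x z w :: real
    by (auto simp: algebra_simps)
  show ?thesis
    unfolding steady_state_def job_search_dynamics_def stay_prob_eq[OF deg_pos[OF assms]] hires p_eq q_eq
    by simp
qed

lemma pick_prob_pos:
  assumes "deg A i > 0" "0 < v" "v \<le> 1"
  shows "pick_prob A v i > 0"
  using assms by (simp add: pick_prob_def power_less_one_iff)

text \<open>The balance equations determine the solution up to a scalar \<phi>, which the total mass
  then fixes. An equivalence yields existence as well as uniqueness.\<close>

lemma steady_state_iff:
  fixes A :: "real^'n^'n"
  assumes "CARD('n) \<ge> 2" and net: "labor_flow_network A"
    and "0 < v" "v \<le> 1" "0 < l" and h: "\<And>i. 0 < h $ i"
  shows "steady_state A v l h p q \<longleftrightarrow>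
    (\<exists>\<phi>. \<phi> * (\<Sum>i\<in>UNIV. h $ i * (\<Sum>j\<in>nbrs A i. h $ j) / l + h $ i / pick_prob A v i) = 1 \<and>
         p = (\<chi> i. \<phi> * (h $ i * (\<Sum>j\<in>nbrs A i. h $ j) / l)) \<and>
         q = (\<chi> i. \<phi> * (h $ i / pick_prob A v i)))"
    (is "_ \<longleftrightarrow> (\<exists>\<phi>. ?sol \<phi>)")
proof -
  have c: "pick_prob A v i > 0" for i
    using assms by (intro pick_prob_pos deg_pos) auto
  show ?thesis
  proof
    assume st: "steady_state A v l h p q"
    note bal = st[unfolded steady_state_iff_balance[OF assms(1) net]]
    define y where "y i = q $ i * pick_prob A v i / h $ i" for i
    have x: "q $ i * pick_prob A v i = h $ i * y i" for i
      using h[of i] by (simp add: y_def)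
    have "(\<Sum>j\<in>nbrs A i. h $ i * h $ j * (y i - y j)) = 0" for i
    proof -
      \<comment> \<open>Equate the two expressions for \<open>l * p $ i\<close>; the rearranged
        equation is harmonicity of \<open>y\<close>.\<close>
      have "h $ i * (\<Sum>j\<in>nbrs A i. h $ j * y j) = h $ i * y i * (\<Sum>j\<in>nbrs A i. h $ j)"
        using bal by (metis (no_types, lifting) mult.assoc sum.cong x)
      then show ?thesis
        by (simp add: algebra_simps sum_subtractf sum_distrib_left)
    qed
    then have const: "y i = y j" for i j
      by (rule harmonic_imp_constant[OF net, rotated]) (simp add: h)
    \<comment> \<open>Since \<open>y\<close> is constant, any firm can serve as the reference;
      \<open>undefined\<close> names an arbitrary one.\<close>
    define \<phi> where "\<phi> = y undefined"
    have y: "y i = \<phi>" for i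
      unfolding \<phi>_def by (rule const)
    have q: "q $ i = \<phi> * (h $ i / pick_prob A v i)" for i
      using x[of i] c[of i] by (simp add: y field_simps)
    have p: "p $ i = \<phi> * (h $ i * (\<Sum>j\<in>nbrs A i. h $ j) / l)" for i
    proof -
      have "l * p $ i = (q $ i * pick_prob A v i) * (\<Sum>j\<in>nbrs A i. h $ j)"
        using bal by (metis mult.assoc)
      then show ?thesis
        using \<open>0 < l\<close> by (simp add: x y field_simps)
    qed
    have "?sol \<phi>"
      using bal by (simp add: p q vec_eq_iff sum.distrib distrib_left sum_distrib_left)
    then show "\<exists>\<phi>. ?sol \<phi>" ..
  next
    assume "\<exists>\<phi>. ?sol \<phi>"
    then obtain \<phi> where sol: "?sol \<phi>" ..
    \<comment> \<open>The hiring flow from \<open>j\<close> to a neighbor \<open>i\<close> is then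
      \<open>\<phi> * h $ j * h $ i\<close>, symmetric in the two firms, so both balance equations
      coincide.\<close>
    have x: "q $ i * pick_prob A v i = \<phi> * h $ i" for i
      using sol c[of i] by simp
    have "l * p $ i = \<phi> * h $ i * (\<Sum>j\<in>nbrs A i. h $ j)" for i
      using sol \<open>0 < l\<close> by simp
    moreover have "(\<Sum>i\<in>UNIV. p $ i) + (\<Sum>i\<in>UNIV. q $ i) = 1"
      using sol by (simp add: sum.distrib distrib_left sum_distrib_left)
    ultimately show "steady_state A v l h p q"
      unfolding steady_state_iff_balance[OF assms(1) net]
      by (simp add: x mult.assoc[symmetric] flip: sum_distrib_left)
  qed
qed

theorem proposition2:
  fixes A :: "real^'n^'n" and v l :: real and h :: "real^'n" and H :: nat
  assumes "CARD('n) \<ge> 2"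
    and "labor_flow_network A"
    and "0 < v" and "v \<le> 1"
    and "0 < l" and "l \<le> 1"
    and "\<And>i. 0 < h $ i \<and> h $ i \<le> 1"
  shows "(\<exists>!s. case s of (p, q) \<Rightarrow> steady_state A v l h p q) \<and>
    (\<forall>p q. steady_state A v l h p q \<longrightarrow>
      (\<forall>i. average_size H p i
         = norm_const H A v l h / l * h $ i * nbr_avg A h i * real (deg A i)))"
proof -
  have h: "0 < h $ i" for i
    using assms(7) by blast
  define g where "g i = (\<Sum>j\<in>nbrs A i. h $ j)" for i
  \<comment> \<open>The total mass of the solution with \<phi> = 1, so normalization forces \<phi> =
    \<open>1 / D\<close>.\<close>
  define D where "D = (\<Sum>i\<in>UNIV. h $ i * g i / l + h $ i / pick_prob A v i)"
  note iff = steady_state_iff[where h = h, OF assms(1-5) h, folded g_def, folded D_def]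
  have d: "deg A i > 0" for i
    using assms(1,2) by (rule deg_pos)
  have c: "pick_prob A v i > 0" for i
    using d assms(3,4) by (rule pick_prob_pos)
  have g: "g i > 0" for i
    unfolding g_def using d[of i] h by (intro sum_pos) (auto simp: deg_def card_gt_0_iff)
  have "D > 0"
    unfolding D_def using h g c \<open>0 < l\<close> by (intro sum_pos) (auto intro!: add_pos_pos)
  then have D: "\<phi> * D = 1 \<longleftrightarrow> \<phi> = 1 / D" for \<phi>
    by (auto simp: field_simps)
  have avg: "nbr_avg A h i = g i / real (deg A i)" for i
    using sum_adjacency_eq_sum_nbrs[OF assms(2), of i "\<lambda>j. h $ j"] by (simp add: nbr_avg_def g_def)
  have avg_deg: "nbr_avg A h i * real (deg A i) = g i" for i
    using d[of i] by (simp add: avg)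
  \<comment> \<open>Summand by summand, the denominator of \<open>norm_const\<close> is
    \<open>D\<close>: the factor \<open>g i\<close> cancels in the second term. The normalizing
    constant is thus \<open>H\<close> times the scalar \<phi>.\<close>
  have "h $ i * nbr_avg A h i * real (deg A i) *
      (1 / l + 1 / (nbr_avg A h i * (1 - (1 - v) ^ deg A i))) = h $ i * g i / l + h $ i / pick_prob A v i" for i
  proof -
    have "nbr_avg A h i * (1 - (1 - v) ^ deg A i) = g i * pick_prob A v i"
      by (simp add: avg pick_prob_def)
    then show ?thesis
      using g[of i] c[of i] by (simp add: mult.assoc avg_deg distrib_left)
  qed
  then have norm: "norm_const H A v l h = real H / D"
    by (simp add: norm_const_def D_def)
  show ?thesis
  proof
    show "\<exists>!s. case s of (p, q) \<Rightarrow> steady_state A v l h p q"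
      unfolding iff D by auto
    show "\<forall>p q. steady_state A v l h p q \<longrightarrow>
      (\<forall>i. average_size H p i
         = norm_const H A v l h / l * h $ i * nbr_avg A h i * real (deg A i))"
      unfolding iff D norm by (auto simp: average_size_def mult.assoc avg_deg)
  qed
qed

end
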